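(* Let $u$ be a normalized covering vector for $R(\mathbb{Z})$ with $\mathrm{nrm}(u)>3$. The limit set of $\Gamma_u$ is the closure of (the union of the spheres in) $\mathcal{A}_{R(\mathbb{Z}),u}$.
   Context: Fix $\dim\in\{3,4,5\}$. If $\dim=3$, $R(\mathbb{Z})$ is the ring of integers of an imaginary quadratic field; if $\dim=4$, a maximal $\ddagger$-order of a rational definite quaternion algebra $\left(\frac{a,b}{\mathbb{Q}}\right)$ with orthogonal involution $(x+yi+zj+tij)^\ddagger=x+yi+zj-tij$; if $\dim=5$, a maximal order of a rational definite quaternion algebra. $\mathrm{nrm}(\alpha)=\alpha\bar\alpha$. $R(\mathbb{Z})^+$ is the $\ddagger$-fixed part if $\dim=4$ and $R(\mathbb{Z})$ otherwise; $R(\mathbb{R})^+=R(\mathbb{Z})^+\otimes\mathbb{R}$ is identified with Euclidean $\mathbb{R}^{\dim-1}$, and $R(\mathbb{R})^+\cup\{\infty\}$ with the boundary of $\mathbb{H}^{\dim}$. For nonzero $u$, $S_u$ is the hyperplane through $0$ orthogonal to $u$, oriented with interior the open half-space containing $u$; $-S$ denotes $S$ with reversed orientation. A nonzero $u$ with real part $0$ is a covering vector if open unit balls centered at the points of $S_u\cap R(\mathbb{Z})$ cover $S_u$; normalized if also $u\in R(\mathbb{Z})^+$ and $u/k\notin R(\mathbb{Z})$ for integers $k>1$. Choose $\tau\in R(\mathbb{Z})^+$ in the interior of $S_u$ such that $S_u\cap R(\mathbb{Z})^+$ and $\tau$ generate $R(\mathbb{Z})^+$. $\Gamma_u$ is the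 group of Möbius transformations generated by the translations $z\mapsto z+\omega$ for $\omega\in R(\mathbb{Z})^+\cap S_u$ and the inversions in unit spheres centered at points of $R(\mathbb{Z})^+\cap S_u$ and of $R(\mathbb{Z})^+\cap(S_u+\tau)$. $\mathcal{A}_{R(\mathbb{Z}),u}$ is the union of the $\Gamma_u$-orbits of the oriented spheres $S_u$ and $-S_u+\tau$. *)

theory Defs
  imports
    "HOL-Analysis.Analysis"
    "HOL-Algebra.Bij"
    "HOL-Algebra.Generated_Groups"
    "HOL-Computational_Algebra.Polynomial"
    "HOL-Computational_Algebra.Group_Closure"
begin

text \<open>
  All three kinds of rings are realised inside Hamilton's quaternions. A quaternion
  \<open>x + yI + zJ + tIJ\<close> is the pair of complex numbers \<open>(x + y\<i>, z + t\<i>)\<close>, so that the norm and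
  inner product of the product type are the Euclidean ones in the coordinates \<open>x, y, z, t\<close>.
\<close>

type_synonym quat = "complex \<times> complex"

definition qone :: quat where
  "qone = (1, 0)"

definition qmul :: "quat \<Rightarrow> quat \<Rightarrow> quat" where
  "qmul p q = (fst p * fst q - snd p * cnj (snd q), fst p * snd q + snd p * cnj (fst q))"

definition qcnj :: "quat \<Rightarrow> quat" where
  "qcnj q = (cnj (fst q), - snd q)"

definition qdag :: "quat \<Rightarrow> quat" where
  "qdag q = (fst q, cnj (snd q))"

definition qRe :: "quat \<Rightarrow> real" where
  "qRe q = Re (fst q)"

text \<open>The product \<open>qmul q (qcnj q)\<close> is always real.\<close>

definition nrm :: "quat \<Rightarrow> real" where
  "nrm q = qRe (qmul q (qcnj q))"

text \<open>
  The imaginary quadratic field \<open>\<rat>(\<surd>d)\<close> for \<open>d < 0\<close> (not necessarily squarefree).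
\<close>

definition quadratic_field :: "int \<Rightarrow> complex set" where
  "quadratic_field d = {of_rat x + of_rat y * csqrt (of_int d) | x y. True}"

definition quadratic_integers :: "int \<Rightarrow> quat set" where
  "quadratic_integers d = {(\<alpha>, 0) | \<alpha>. \<alpha> \<in> quadratic_field d \<and> algebraic_int \<alpha>}"

text \<open>
  The rational quaternion algebra with \<open>i\<^sup>2 = a\<close> and \<open>j\<^sup>2 = b\<close>. It is definite exactly if \<open>a < 0\<close> and
  \<open>b < 0\<close>, and then \<open>i = \<surd>(-a) I\<close>, \<open>j = \<surd>(-b) J\<close>, \<open>ij = \<surd>(ab) IJ\<close> embeds it into Hamilton's
  quaternions. Under this embedding \<open>qdag\<close> negates the coefficient of \<open>ij\<close> only.
\<close>

definition quat_algebra :: "rat \<Rightarrow> rat \<Rightarrow> quat set" where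
  "quat_algebra a b =
     {(Complex (of_rat x) (of_rat y * sqrt (of_rat (- a))),
       Complex (of_rat z * sqrt (of_rat (- b))) (of_rat t * sqrt (of_rat (a * b)))) | x y z t. True}"

text \<open>
  An order is a subring with 1 that is a finitely generated \<open>\<int>\<close>-module spanning the algebra over
  \<open>\<rat>\<close>; the last condition says that each element has a nonzero integer multiple in the order.
\<close>

definition quat_order :: "rat \<Rightarrow> rat \<Rightarrow> quat set \<Rightarrow> bool" where
  "quat_order a b R \<longleftrightarrow>
     R \<subseteq> quat_algebra a b \<and> qone \<in> R \<and>
     (\<forall>p\<in>R. \<forall>q\<in>R. qmul p q \<in> R) \<and>
     (\<exists>B. finite B \<and> R = group_closure B) \<and>
     (\<forall>q\<in>quat_algebra a b. \<exists>k::int. k \<noteq> 0 \<and> of_int k *\<^sub>R q \<in> R)"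

definition maximal_order :: "rat \<Rightarrow> rat \<Rightarrow> quat set \<Rightarrow> bool" where
  "maximal_order a b R \<longleftrightarrow>
     quat_order a b R \<and> (\<forall>R'. quat_order a b R' \<and> R \<subseteq> R' \<longrightarrow> R' = R)"

definition dagger_order :: "rat \<Rightarrow> rat \<Rightarrow> quat set \<Rightarrow> bool" where
  "dagger_order a b R \<longleftrightarrow> quat_order a b R \<and> qdag ` R = R"

definition maximal_dagger_order :: "rat \<Rightarrow> rat \<Rightarrow> quat set \<Rightarrow> bool" where
  "maximal_dagger_order a b R \<longleftrightarrow>
     dagger_order a b R \<and> (\<forall>R'. dagger_order a b R' \<and> R \<subseteq> R' \<longrightarrow> R' = R)"

text \<open>\<open>n\<close> is the dimension of the hyperbolic space.\<close>

definition integral_ring :: "nat \<Rightarrow> quat set \<Rightarrow> bool" where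
  "integral_ring n R \<longleftrightarrow>
     n = 3 \<and> (\<exists>d<0. R = quadratic_integers d) \<or>
     n = 4 \<and> (\<exists>a<0. \<exists>b<0. maximal_dagger_order a b R) \<or>
     n = 5 \<and> (\<exists>a<0. \<exists>b<0. maximal_order a b R)"

definition plus_part :: "nat \<Rightarrow> quat set \<Rightarrow> quat set" where
  "plus_part n R = (if n = 4 then {q \<in> R. qdag q = q} else R)"

text \<open>
  \<open>R(\<int>)\<^sup>+ \<otimes> \<real>\<close>, a real subspace of dimension \<open>n - 1\<close> with the Euclidean structure of the norm form.
\<close>

definition real_plus :: "nat \<Rightarrow> quat set \<Rightarrow> quat set" where
  "real_plus n R = span (plus_part n R)"

definition hplane :: "nat \<Rightarrow> quat set \<Rightarrow> quat \<Rightarrow> quat set" where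
  "hplane n R u = {x \<in> real_plus n R. u \<bullet> x = 0}"

definition hplane_interior :: "nat \<Rightarrow> quat set \<Rightarrow> quat \<Rightarrow> quat set" where
  "hplane_interior n R u = {x \<in> real_plus n R. u \<bullet> x > 0}"

definition covering_vector :: "nat \<Rightarrow> quat set \<Rightarrow> quat \<Rightarrow> bool" where
  "covering_vector n R u \<longleftrightarrow>
     u \<in> real_plus n R \<and> u \<noteq> 0 \<and> qRe u = 0 \<and>
     hplane n R u \<subseteq> (\<Union>c \<in> hplane n R u \<inter> R. ball c 1)"

definition normalized_covering_vector :: "nat \<Rightarrow> quat set \<Rightarrow> quat \<Rightarrow> bool" where
  "normalized_covering_vector n R u \<longleftrightarrow>
     covering_vector n R u \<and> u \<in> plus_part n R \<and>
     (\<forall>k::int. k > 1 \<longrightarrow> u /\<^sub>R of_int k \<notin> R)"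

definition transversal_vector :: "nat \<Rightarrow> quat set \<Rightarrow> quat \<Rightarrow> quat \<Rightarrow> bool" where
  "transversal_vector n R u \<tau> \<longleftrightarrow>
     \<tau> \<in> plus_part n R \<and> \<tau> \<in> hplane_interior n R u \<and>
     group_closure (insert \<tau> (hplane n R u \<inter> plus_part n R)) = plus_part n R"

text \<open>
  For \<open>V = real_plus n R\<close>, hyperbolic space is the upper half-space of the points \<open>Some (x, t)\<close> with
  \<open>x \<in> V\<close> and \<open>t > 0\<close>. Its boundary \<open>V \<union> {\<infinity>}\<close> consists of the points \<open>Some (x, 0)\<close> with \<open>x \<in> V\<close>
  and of \<open>None\<close>, the point at infinity. The topology is that of the one-point compactification.
  The translation by \<open>w\<close> and the inversion in the unit sphere centered at \<open>c\<close>, for \<open>w, c \<in> V\<close>, are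
  given directly with their Poincare extensions, that is as the translation by \<open>(w, 0)\<close> and the
  inversion in the unit sphere centered at \<open>(c, 0)\<close>. (They are functions on the whole type, which
  is larger than the closure of hyperbolic space if \<open>n < 5\<close>, but they preserve the latter.)
\<close>

type_synonym hpoint = "(quat \<times> real) option"

definition hpoint_topology :: "hpoint topology" where
  "hpoint_topology = Alexandroff_compactification euclidean"

definition boundary_point :: "quat \<Rightarrow> hpoint" where
  "boundary_point x = Some (x, 0)"

definition hyp_space :: "quat set \<Rightarrow> hpoint set" where
  "hyp_space V = {Some (x, t) | x t. x \<in> V \<and> t > 0}"

definition hyp_boundary :: "quat set \<Rightarrow> hpoint set" where
  "hyp_boundary V = insert None (boundary_point ` V)"

definition mobius_translation :: "quat \<Rightarrow> hpoint \<Rightarrow> hpoint" where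
  "mobius_translation w = map_option (\<lambda>p. p + (w, 0))"

definition mobius_inversion :: "quat \<Rightarrow> hpoint \<Rightarrow> hpoint" where
  "mobius_inversion c P =
     (case P of
        None \<Rightarrow> Some (c, 0)
      | Some p \<Rightarrow> if p = (c, 0) then None
                  else Some ((c, 0) + (p - (c, 0)) /\<^sub>R (norm (p - (c, 0)))\<^sup>2))"

definition Gamma_group :: "nat \<Rightarrow> quat set \<Rightarrow> quat \<Rightarrow> quat \<Rightarrow> (hpoint \<Rightarrow> hpoint) set" where
  "Gamma_group n R u \<tau> =
     generate (BijGroup UNIV)
       (mobius_translation ` (plus_part n R \<inter> hplane n R u) \<union>
        mobius_inversion ` (plus_part n R \<inter> hplane n R u) \<union>
        mobius_inversion ` (plus_part n R \<inter> (\<lambda>x. x + \<tau>) ` hplane n R u))"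

text \<open>
  A boundary point is a limit point of \<open>G\<close> if some sequence \<open>g\<^sub>i P\<close> with \<open>g\<^sub>i \<in> G\<close> and \<open>P\<close> in hyperbolic
  space converges to it.
\<close>

definition limit_set :: "quat set \<Rightarrow> (hpoint \<Rightarrow> hpoint) set \<Rightarrow> hpoint set" where
  "limit_set V G =
     {Q \<in> hyp_boundary V. \<exists>P \<in> hyp_space V. \<exists>g :: nat \<Rightarrow> hpoint \<Rightarrow> hpoint.
        (\<forall>i. g i \<in> G) \<and> limitin hpoint_topology (\<lambda>i. g i P) Q sequentially}"

text \<open>
  An oriented sphere in the boundary is the pair of its underlying point set and its interior.
\<close>

type_synonym osphere = "hpoint set \<times> hpoint set"

definition S_sphere :: "nat \<Rightarrow> quat set \<Rightarrow> quat \<Rightarrow> osphere" where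
  "S_sphere n R u =
     (insert None (boundary_point ` hplane n R u), boundary_point ` hplane_interior n R u)"

definition osphere_reverse :: "quat set \<Rightarrow> osphere \<Rightarrow> osphere" where
  "osphere_reverse V S = (fst S, hyp_boundary V - (fst S \<union> snd S))"

definition osphere_image :: "(hpoint \<Rightarrow> hpoint) \<Rightarrow> osphere \<Rightarrow> osphere" where
  "osphere_image g S = (g ` fst S, g ` snd S)"

definition packing :: "nat \<Rightarrow> quat set \<Rightarrow> quat \<Rightarrow> quat \<Rightarrow> osphere set" where
  "packing n R u \<tau> =
     {osphere_image g (S_sphere n R u) | g. g \<in> Gamma_group n R u \<tau>} \<union>
     {osphere_image g (osphere_image (mobius_translation \<tau>)
        (osphere_reverse (real_plus n R) (S_sphere n R u))) | g. g \<in> Gamma_group n R u \<tau>}"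

end

theory Submission
  imports Defs
begin

text \<open>
  The inversion centers in \<open>S\<^sub>u\<close> form a net of some radius \<open>r < 1\<close>. Hence inversions enlarge any ball of
  \<open>S\<^sub>u\<close> until it contains a center, so the orbit of \<open>\<infinity>\<close> is dense in \<open>S\<^sub>u\<close>, and likewise in \<open>S\<^sub>u + \<tau>\<close>.
  Every orbit in hyperbolic space accumulates at \<open>\<infinity>\<close>, thus also at every point of the packing.
  Conversely, if \<open>g P\<close> is close to the boundary point \<open>q\<close>, then so is \<open>g (0, 1)\<close>, because \<open>g\<close> is a
  hyperbolic isometry. This point lies on the geodesic from \<open>g 0\<close> to \<open>g \<infinity>\<close>, so one of these two points
  of the packing is close to \<open>q\<close>.
\<close>

section \<open>The compactified half-space\<close>

text \<open>Heine-Borel turns the compact complements of neighborhoods of infinity into bounded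
  ones, so that all later topology becomes Euclidean.\<close>

lemma openin_hpoint_topology:
  "openin hpoint_topology W \<longleftrightarrow>
     open (Some -` W) \<and> (None \<in> W \<longrightarrow> bounded (- (Some -` W)))"
proof (cases "None \<in> W")
  case True
  have "openin hpoint_topology W \<longleftrightarrow> (\<exists>C. compact C \<and> closed C \<and> W = insert None (Some ` (- C)))"
    using True by (auto simp: hpoint_topology_def openin_Alexandroff_compactification Compl_eq_Diff_UNIV)
  also have "\<dots> \<longleftrightarrow> (\<exists>C. compact C \<and> closed C \<and> C = - (Some -` W))"
  proof -
    have "W = insert None (Some ` (- C)) \<longleftrightarrow> C = - (Some -` W)" for C
    proof
      assume "C = - (Some -` W)"
      then show "W = insert None (Some ` (- C))"
        using True by (auto simp: image_iff)
    qed auto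
    then show ?thesis by simp
  qed
  also have "\<dots> \<longleftrightarrow> open (Some -` W) \<and> bounded (- (Some -` W))"
    by (auto simp: compact_eq_bounded_closed closed_open)
  finally show ?thesis using True by simp
next
  case False
  have *: "W = Some ` (Some -` W)"
  proof -
    have "x \<in> Some ` (Some -` W)" if "x \<in> W" for x
      using that False by (cases x) auto
    then show ?thesis by auto
  qed
  have "openin hpoint_topology W \<longleftrightarrow> openin hpoint_topology (Some ` (Some -` W))"
    using * by simp
  also have "\<dots> \<longleftrightarrow> open (Some -` W)"
    by (simp add: hpoint_topology_def del: image_vimage_eq)
  finally show ?thesis using False by simp
qed

lemma topspace_hpoint_topology [simp]: "topspace hpoint_topology = UNIV"
  by (simp add: hpoint_topology_def UNIV_option_conv)

lemma closedin_hpoint_topology_vimage: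
  assumes "closedin hpoint_topology C"
  shows "closed (Some -` C)"
proof -
  have "openin hpoint_topology (- C)"
    using assms by (simp add: closedin_def Compl_eq_Diff_UNIV)
  then have "open (Some -` (- C))"
    by (simp add: openin_hpoint_topology)
  then show ?thesis
    by (simp add: closed_def vimage_Compl)
qed

text \<open>The embedding \<open>Some\<close> is open and continuous, so near a finite point the
  topology is the Euclidean one.\<close>

lemma Some_in_closure_hpoint:
  "Some p \<in> hpoint_topology closure_of A \<longleftrightarrow> p \<in> closure (Some -` A)"
proof
  assume p: "Some p \<in> hpoint_topology closure_of A"
  show "p \<in> closure (Some -` A)"
    unfolding closure_approachable
  proof safe
    fix e :: real assume "e > 0"
    have "openin hpoint_topology (Some ` ball p e)"
      by (simp add: hpoint_topology_def)
    with p \<open>e > 0\<close> obtain y where "y \<in> A" "y \<in> Some ` ball p e"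
      unfolding in_closure_of by (metis centre_in_ball imageI)
    then show "\<exists>y\<in>Some -` A. dist y p < e"
      by (auto simp: dist_commute)
  qed
next
  have "Some ` closure (Some -` A) \<subseteq> hpoint_topology closure_of (Some ` (Some -` A))"
    using continuous_map_image_closure_subset[OF continuous_map_Some[of euclidean], of "Some -` A"]
    by (simp add: hpoint_topology_def del: image_vimage_eq)
  also have "\<dots> \<subseteq> hpoint_topology closure_of A"
    by (rule closure_of_mono) auto
  finally show "Some p \<in> hpoint_topology closure_of A" if "p \<in> closure (Some -` A)"
    using that by auto
qed

lemma None_in_closure_hpoint:
  "None \<in> hpoint_topology closure_of A \<longleftrightarrow> None \<in> A \<or> \<not> bounded (Some -` A)"
proof
  assume *: "None \<in> hpoint_topology closure_of A"
  show "None \<in> A \<or> \<not> bounded (Some -` A)"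
  proof (rule ccontr)
    assume "\<not> ?thesis"
    then have nA: "None \<notin> A" and b: "bounded (Some -` A)" by auto
    \<comment> \<open>A neighborhood of infinity that misses \<open>A\<close>; boundedness of
      \<open>A\<close> is what makes it open.\<close>
    define W where "W = insert None (Some ` (- closure (Some -` A)))"
    have v: "Some -` W = - closure (Some -` A)" by (auto simp: W_def)
    have "openin hpoint_topology W"
      unfolding openin_hpoint_topology v using b by (simp add: open_Compl bounded_closure)
    moreover have "None \<in> W" by (simp add: W_def)
    ultimately obtain y where "y \<in> A" "y \<in> W"
      using * unfolding in_closure_of by blast
    then show False
      using nA closure_subset[of "Some -` A"] by (auto simp: W_def)
  qed
next
  assume *: "None \<in> A \<or> \<not> bounded (Some -` A)"
  show "None \<in> hpoint_topology closure_of A"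
    unfolding in_closure_of
  proof (intro conjI allI impI)
    fix T assume T: "None \<in> T \<and> openin hpoint_topology T"
    show "\<exists>y. y \<in> A \<and> y \<in> T"
    proof (rule ccontr)
      assume no: "\<not> ?thesis"
      then have "Some -` A \<subseteq> - (Some -` T)" by auto
      moreover have "bounded (- (Some -` T))"
        using T by (simp add: openin_hpoint_topology)
      ultimately show False
        using * no T bounded_subset by blast
    qed
  qed simp
qed

text \<open>\<open>limit_set\<close> is defined by sequences, so closure points have to be reached
  by sequences. Finite points inherit this from the metric. At infinity, either the constant
  sequence serves or points of norm greater than \<open>i\<close> do.\<close>

lemma closure_hpoint_sequential:
  assumes "Q \<in> hpoint_topology closure_of A"
  shows "\<exists>f. (\<forall>i::nat. f i \<in> A) \<and> limitin hpoint_topology f Q sequentially"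
proof (cases Q)
  case (Some q)
  then obtain x where x: "\<And>n. x n \<in> Some -` A" "x \<longlonglongrightarrow> q"
    using assms by (auto simp: Some_in_closure_hpoint closure_sequential)
  have "limitin hpoint_topology (Some \<circ> x) (Some q) sequentially"
    unfolding hpoint_topology_def using x(2)
    by (intro continuous_map_limit[OF continuous_map_Some[of euclidean]])
      (simp add: limitin_canonical_iff)
  then show ?thesis
    using x(1) Some by (intro exI[of _ "Some \<circ> x"]) auto
next
  case None
  show ?thesis
  proof (cases "None \<in> A")
    case True
    then show ?thesis
      using None by (intro exI[of _ "\<lambda>_. None"]) (simp add: limitin_const_iff limitin_def)
  next
    case False
    then have unb: "\<not> bounded (Some -` A)"
      using assms None by (simp add: None_in_closure_hpoint)
    have "\<exists>x. Some x \<in> A \<and> norm x > real i" for i :: nat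
    proof (rule ccontr)
      assume "\<not> ?thesis"
      then have "\<forall>x\<in>Some -` A. norm x \<le> real i" by (auto simp: not_less)
      then show False using unb unfolding bounded_iff by blast
    qed
    then obtain x where x: "\<And>i. Some (x i) \<in> A" "\<And>i. norm (x i) > real i"
      by metis
    have "limitin hpoint_topology (\<lambda>i. Some (x i)) None sequentially"
      unfolding limitin_def
    proof (intro conjI allI impI)
      fix U assume U: "openin hpoint_topology U \<and> None \<in> U"
      then have "bounded (- (Some -` U))"
        by (simp add: openin_hpoint_topology)
      then obtain B where B: "\<And>y. Some y \<notin> U \<Longrightarrow> norm y \<le> B"
        by (auto simp: bounded_iff)
      have "\<forall>i\<ge>nat \<lceil>B\<rceil>. Some (x i) \<in> U"
      proof (intro allI impI, rule ccontr)
        fix i assume i: "nat \<lceil>B\<rceil> \<le> i" and "Some (x i) \<notin> U"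
        from this(2) have "norm (x i) \<le> B" by (rule B)
        with x(2)[of i] i show False by linarith
      qed
      then show "\<forall>\<^sub>F i in sequentially. Some (x i) \<in> U"
        unfolding eventually_sequentially by blast
    qed simp
    then show ?thesis
      unfolding None using x(1) by (intro exI[of _ "\<lambda>i. Some (x i)"]) simp
  qed
qed

section \<open>Translations and inversions\<close>

lemma mobius_translation_simps [simp]:
  "mobius_translation w None = None"
  "mobius_translation w (Some p) = Some (p + (w, 0))"
  by (simp_all add: mobius_translation_def)

lemma mobius_translation_compose:
  "mobius_translation v (mobius_translation w P) = mobius_translation (v + w) P"
  by (cases P) (simp_all add: algebra_simps)

lemma mobius_translation_zero [simp]: "mobius_translation 0 = id"
proof
  show "mobius_translation 0 P = id P" for P
    by (cases P) (simp_all flip: zero_prod_def)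
qed

lemma mobius_inversion_simps:
  "mobius_inversion 0 None = Some 0"
  "mobius_inversion 0 (Some p) = (if p = 0 then None else Some (p /\<^sub>R (norm p)\<^sup>2))"
  by (simp_all add: mobius_inversion_def flip: zero_prod_def)

text \<open>Reduces every property stable under composition to translations and the single inversion
  at the origin.\<close>

lemma mobius_inversion_conj:
  "mobius_inversion c = mobius_translation c \<circ> mobius_inversion 0 \<circ> mobius_translation (- c)"
proof
  fix P
  have *: "p + (- c, 0) = p - (c, 0)" for p :: "quat \<times> real"
    by (simp add: prod_eq_iff)
  show "mobius_inversion c P = (mobius_translation c \<circ> mobius_inversion 0 \<circ> mobius_translation (- c)) P"
  proof (cases P)
    case None
    then show ?thesis by (simp add: mobius_inversion_simps mobius_inversion_def[of c])
  next
    case (Some p)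
    have "p - (c, 0) = 0 \<longleftrightarrow> p = (c, 0)" by simp
    then show ?thesis
      unfolding Some comp_apply mobius_translation_simps * mobius_inversion_simps
      by (simp only: mobius_inversion_def[of c] option.case split: if_split)
        (simp add: add.commute)
  qed
qed

lemma mobius_inversion_zero_involution:
  "mobius_inversion 0 (mobius_inversion 0 P) = P"
proof (cases P)
  case (Some p)
  then show ?thesis
    by (cases "p = 0") (simp_all add: mobius_inversion_simps power2_eq_square field_simps)
qed (simp add: mobius_inversion_simps)

lemma mobius_inversion_involution:
  "mobius_inversion c (mobius_inversion c P) = P"
  by (simp add: mobius_inversion_conj[of c] mobius_translation_compose mobius_inversion_zero_involution)

lemma mobius_translation_inverse:
  "mobius_translation (- w) \<circ> mobius_translation w = id"
  "mobius_translation w \<circ> mobius_translation (- w) = id"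
  by (auto simp: mobius_translation_compose)

lemma mobius_inversion_inverse: "mobius_inversion c \<circ> mobius_inversion c = id"
  by (simp add: fun_eq_iff mobius_inversion_involution)

lemma mobius_inversion_boundary_point:
  assumes "y \<noteq> c"
  shows "mobius_inversion c (boundary_point y) = boundary_point (c + (y - c) /\<^sub>R (norm (y - c))\<^sup>2)"
  using assms by (simp add: mobius_inversion_def boundary_point_def norm_Pair)

lemma mobius_translation_boundary_point:
  "mobius_translation w (boundary_point x) = boundary_point (x + w)"
  by (simp add: boundary_point_def)

lemma continuous_mobius_translation:
  "continuous_map hpoint_topology hpoint_topology (mobius_translation w)"
  unfolding continuous_map_def
proof (intro conjI allI impI)
  fix W assume W: "openin hpoint_topology W"
  have v: "Some -` {P \<in> topspace hpoint_topology. mobius_translation w P \<in> W}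
      = (+) (- w, 0) ` (Some -` W)"
  proof -
    have "p \<in> (+) (- w, 0) ` (Some -` W)" if "Some (p + (w, 0)) \<in> W" for p
      using that by (intro image_eqI[of _ _ "p + (w, 0)"]) (auto simp: prod_eq_iff)
    then show ?thesis by auto
  qed
  have "- (+) (- w, 0) ` (Some -` W) = (+) (- w, 0) ` (- (Some -` W))"
    by (rule translation_Compl[symmetric])
  then show "openin hpoint_topology {P \<in> topspace hpoint_topology. mobius_translation w P \<in> W}"
    using W unfolding openin_hpoint_topology v
    by (simp add: open_translation bounded_translation)
qed simp

text \<open>Away from 0 and infinity the map is the continuous \<open>J\<close>. Since
  \<open>J\<close> inverts norms, it exchanges small balls around 0 with complements of large balls,
  which settles the two exceptional points.\<close>

lemma continuous_mobius_inversion_zero: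
  "continuous_map hpoint_topology hpoint_topology (mobius_inversion 0)"
  unfolding continuous_map_def
proof (intro conjI allI impI)
  fix W assume W: "openin hpoint_topology W"
  define U where "U = Some -` W"
  define J where "J = (\<lambda>p::quat \<times> real. p /\<^sub>R (norm p)\<^sup>2)"
  define U' where "U' = Some -` {P \<in> topspace hpoint_topology. mobius_inversion 0 P \<in> W}"
  have U: "open U" and UN: "None \<in> W \<Longrightarrow> bounded (- U)"
    using W by (auto simp: openin_hpoint_topology U_def)
  have U'_iff: "p \<in> U' \<longleftrightarrow> (if p = 0 then None \<in> W else J p \<in> U)" for p
    by (simp add: U'_def mobius_inversion_simps U_def J_def)
  have nJ: "norm (J p) = inverse (norm p)" for p
    by (cases "p = 0") (simp_all add: J_def power2_eq_square)
  have "open (J -` U \<inter> (- {0}))"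
  proof -
    have "continuous_on (- {0}) J"
      unfolding J_def by (intro continuous_intros) auto
    then have "openin (top_of_set (- {0})) (- {0} \<inter> J -` U)"
      using U by (simp add: continuous_openin_preimage_gen)
    then show ?thesis
      by (metis Int_commute open_Compl closed_singleton openin_open_eq Int_absorb1 inf_le1)
  qed
  moreover have "\<exists>e>0. ball 0 e \<subseteq> U'" if N: "None \<in> W"
  proof -
    from UN[OF N] obtain B where B: "B > 0" "\<And>y. y \<notin> U \<Longrightarrow> norm y \<le> B"
      by (auto simp: bounded_pos)
    have "p \<in> U'" if "norm p < inverse B" for p
    proof (cases "p = 0")
      case False
      have "B < norm (J p)"
        unfolding nJ using that False B(1)
        by (metis inverse_inverse_eq less_imp_inverse_less zero_less_norm_iff)
      then show ?thesis
        using False B(2)[of "J p"] by (auto simp: U'_iff)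
    qed (use N in \<open>simp add: U'_iff\<close>)
    then show ?thesis
      using B(1) by (intro exI[of _ "inverse B"]) auto
  qed
  ultimately have "open U'"
  proof (cases "None \<in> W")
    case True
    with \<open>None \<in> W \<Longrightarrow> \<exists>e>0. ball 0 e \<subseteq> U'\<close> obtain e where e: "e > 0" "ball 0 e \<subseteq> U'"
      by blast
    then have "p \<in> ball 0 e \<union> J -` U \<inter> (- {0}) \<longleftrightarrow> p \<in> U'" for p
      by (cases "p = 0") (auto simp: U'_iff True)
    then have "U' = ball 0 e \<union> J -` U \<inter> (- {0})"
      by blast
    with \<open>open (J -` U \<inter> (- {0}))\<close> show ?thesis
      by (simp add: open_Un)
  next
    case False
    then have "p \<in> U' \<longleftrightarrow> p \<in> J -` U \<inter> (- {0})" for p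
      by (simp add: U'_iff)
    then have "U' = J -` U \<inter> (- {0})"
      by blast
    with \<open>open (J -` U \<inter> (- {0}))\<close> show ?thesis
      by simp
  qed
  moreover have "bounded (- U')" if "mobius_inversion 0 None \<in> W"
  proof -
    have "0 \<in> U" using that by (simp add: mobius_inversion_simps U_def)
    then obtain e where e: "e > 0" "ball 0 e \<subseteq> U"
      using U open_contains_ball by blast
    have "\<forall>p\<in>- U'. norm p \<le> inverse e"
    proof (intro ballI, rule ccontr)
      fix p assume p: "p \<in> - U'" and "\<not> norm p \<le> inverse e"
      from this(2) have *: "inverse e < norm p" by simp
      then have "norm (J p) < e"
        unfolding nJ using e(1)
        by (metis inverse_inverse_eq less_imp_inverse_less positive_imp_inverse_positive)
      then have "J p \<in> U" using e(2) by (meson mem_ball_0 subsetD)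
      moreover have "p \<noteq> 0" using * e(1) by (auto simp: not_less)
      ultimately show False using p by (simp add: U'_iff)
    qed
    then show ?thesis unfolding bounded_iff by blast
  qed
  ultimately show "openin hpoint_topology {P \<in> topspace hpoint_topology. mobius_inversion 0 P \<in> W}"
    by (simp add: openin_hpoint_topology U'_def)
qed simp

lemma continuous_mobius_inversion:
  "continuous_map hpoint_topology hpoint_topology (mobius_inversion c)"
  unfolding mobius_inversion_conj[of c]
  by (intro continuous_map_compose[of _ hpoint_topology] continuous_mobius_translation
      continuous_mobius_inversion_zero)

section \<open>The linear action on the light cone\<close>

text \<open>
  The point \<open>(x, t)\<close> spans the ray of \<open>(1, x, |x|\<^sup>2 + t\<^sup>2)\<close>, on which inversion in the unit sphere
  at \<open>0\<close> is the exchange of the outer coordinates.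
\<close>

definition on_ray :: "hpoint \<Rightarrow> real \<times> quat \<times> real \<Rightarrow> bool" where
  "on_ray P v \<longleftrightarrow>
     (\<exists>k>0. v = k *\<^sub>R (case P of None \<Rightarrow> (0, 0, 1) | Some p \<Rightarrow> (1, fst p, p \<bullet> p)))"

text \<open>For the Moebius maps below, \<open>T\<close> is the Lorentz transformation for the form
  \<open>\<alpha> * \<beta> - x \<bullet> x\<close> that induces them. Additivity allows the image
  of a point of a geodesic to be compared with the images of its ends.\<close>

definition lifts_linearly :: "(hpoint \<Rightarrow> hpoint) \<Rightarrow> bool" where
  "lifts_linearly f \<longleftrightarrow>
     (\<exists>T. (\<forall>v w. T (v + w) = T v + T w) \<and> (\<forall>P v. on_ray P v \<longrightarrow> on_ray (f P) (T v)))"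

lemma lifts_linearly_compose:
  "lifts_linearly f \<Longrightarrow> lifts_linearly g \<Longrightarrow> lifts_linearly (f \<circ> g)"
  unfolding lifts_linearly_def by (metis comp_apply)

lemma lifts_linearly_translation: "lifts_linearly (mobius_translation w)"
proof -
  \<comment> \<open>Expanding |x + w|^2 + t^2 shows how \<open>\<beta>\<close> changes when
    \<open>\<alpha>\<close> is 1; the factors \<open>\<alpha>\<close> make the formula
    homogeneous.\<close>
  define T :: "real \<times> quat \<times> real \<Rightarrow> real \<times> quat \<times> real" where
    "T = (\<lambda>(\<alpha>, x, \<beta>). (\<alpha>, x + \<alpha> *\<^sub>R w, \<beta> + 2 * (w \<bullet> x) + \<alpha> * (w \<bullet> w)))"
  have "T (v + v') = T v + T v'" for v v'
    by (cases v; cases v') (simp add: T_def algebra_simps inner_add_right)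
  moreover have "on_ray (mobius_translation w P) (T v)" if "on_ray P v" for P v
  proof (cases P)
    case None
    then show ?thesis using that by (auto simp: on_ray_def T_def)
  next
    case (Some p)
    obtain x t where p: "p = (x, t)" by fastforce
    show ?thesis
      using that unfolding Some p on_ray_def T_def
      by (auto simp: scaleR_add_right algebra_simps inner_add_left inner_add_right inner_commute[of x w])
  qed
  ultimately show ?thesis unfolding lifts_linearly_def by blast
qed

lemma lifts_linearly_inversion: "lifts_linearly (mobius_inversion c)"
proof -
  define T :: "real \<times> quat \<times> real \<Rightarrow> real \<times> quat \<times> real" where
    "T = (\<lambda>(\<alpha>, x, \<beta>). (\<beta>, x, \<alpha>))"
  have "T (v + v') = T v + T v'" for v v'
    by (cases v; cases v') (simp add: T_def)
  moreover have "on_ray (mobius_inversion 0 P) (T v)" if rv: "on_ray P v" for P v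
  proof (cases P)
    case None
    then show ?thesis using rv by (auto simp: on_ray_def T_def mobius_inversion_simps)
  next
    case (Some p)
    then obtain k where k: "k > 0" "v = k *\<^sub>R (1, fst p, p \<bullet> p)"
      using rv by (auto simp: on_ray_def)
    show ?thesis
    proof (cases "p = 0")
      case True
      then show ?thesis using Some k by (auto simp: on_ray_def T_def mobius_inversion_simps)
    next
      case False
      then have pp: "p \<bullet> p > 0" by simp
      \<comment> \<open>The inverted point has squared norm 1 / |p|^2, so exchanging the outer
        coordinates gives its ray vector up to the positive factor |p|^2.\<close>
      then have "T v = (k * (p \<bullet> p)) *\<^sub>R
          (1, fst (p /\<^sub>R (norm p)\<^sup>2), (p /\<^sub>R (norm p)\<^sup>2) \<bullet> (p /\<^sub>R (norm p)\<^sup>2))"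
        by (simp add: k(2) T_def power2_norm_eq_inner)
      then show ?thesis
        using False Some k(1) pp unfolding on_ray_def
        by (intro exI[of _ "k * (p \<bullet> p)"]) (simp add: mobius_inversion_simps)
    qed
  qed
  ultimately have "lifts_linearly (mobius_inversion 0)"
    unfolding lifts_linearly_def by blast
  then show ?thesis
    unfolding mobius_inversion_conj[of c]
    by (intro lifts_linearly_compose lifts_linearly_translation)
qed

text \<open>
  In light-cone terms \<open>(0, 1)\<close> is the sum of \<open>0\<close> and \<open>\<infinity>\<close>, and lying outside the half-space over a
  ball is the nonnegativity of a linear functional.
\<close>

lemma geodesic_outside_ball:
  assumes "lifts_linearly g" "\<delta> > 0"
    and out0: "\<And>p. g (Some 0) = Some p \<Longrightarrow> \<delta> \<le> norm (p - (q, 0))"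
    and out1: "\<And>p. g None = Some p \<Longrightarrow> \<delta> \<le> norm (p - (q, 0))"
    and gp: "g (Some (0, 1)) = Some p"
  shows "\<delta> \<le> norm (p - (q, 0))"
proof -
  obtain T where T: "\<And>v w. T (v + w) = T v + T w"
    and ray: "\<And>P v. on_ray P v \<Longrightarrow> on_ray (g P) (T v)"
    using assms(1) unfolding lifts_linearly_def by blast
  \<comment> \<open>The expansion of |(x, t) - (q, 0)|^2 - \<delta>^2, made linear by writing
    \<open>\<beta>\<close> for |x|^2 + t^2 and multiplying the constant by \<open>\<alpha>\<close>.
    It is positive on the ray of infinity, so infinity counts as lying outside every ball.\<close>
  define F :: "real \<times> quat \<times> real \<Rightarrow> real" where
    "F = (\<lambda>(\<alpha>, x, \<beta>). \<beta> - 2 * (q \<bullet> x) + (q \<bullet> q - \<delta>\<^sup>2) * \<alpha>)"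
  have F_add: "F (v + w) = F v + F w" for v w
    by (cases v; cases w) (simp add: F_def algebra_simps inner_add_right)
  have F_Some: "\<exists>k>0. F v = k * ((norm (r - (q, 0)))\<^sup>2 - \<delta>\<^sup>2)" if rv: "on_ray (Some r) v" for r v
  proof -
    obtain x t where r: "r = (x, t)" by fastforce
    obtain k where k: "k > 0" "v = k *\<^sub>R (1, x, (x, t) \<bullet> (x, t))"
      using rv by (auto simp: on_ray_def r)
    have "F v = k * ((norm (r - (q, 0)))\<^sup>2 - \<delta>\<^sup>2)"
      by (simp add: k(2) r F_def power2_norm_eq_inner algebra_simps inner_diff_left inner_diff_right
          inner_commute[of x q])
    with k(1) show ?thesis by blast
  qed
  have F_nonneg: "F v \<ge> 0" if rv: "on_ray Q v" and out: "\<And>r. Q = Some r \<Longrightarrow> \<delta> \<le> norm (r - (q, 0))" for Q v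
  proof (cases Q)
    case None
    then show ?thesis using rv by (auto simp: on_ray_def F_def)
  next
    case (Some r)
    then obtain k where k: "k > 0" "F v = k * ((norm (r - (q, 0)))\<^sup>2 - \<delta>\<^sup>2)"
      using F_Some rv by blast
    have "\<delta>\<^sup>2 \<le> (norm (r - (q, 0)))\<^sup>2"
      using out[OF Some] assms(2) by (intro power_mono) auto
    with k show ?thesis by simp
  qed
  have r0: "on_ray (Some 0) (1, 0, 0)"
    by (auto simp: on_ray_def intro!: exI[of _ 1])
  have r1: "on_ray None (0, 0, 1)"
    by (auto simp: on_ray_def intro!: exI[of _ 1])
  have "on_ray (Some (0, 1)) ((1, 0, 0) + (0, 0, 1))"
    by (auto simp: on_ray_def intro!: exI[of _ 1])
  then have "on_ray (Some p) (T (1, 0, 0) + T (0, 0, 1))"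
    using ray gp T by metis
  then obtain k where "k > 0"
    "F (T (1, 0, 0) + T (0, 0, 1)) = k * ((norm (p - (q, 0)))\<^sup>2 - \<delta>\<^sup>2)"
    using F_Some by blast
  moreover have "F (T (1, 0, 0)) \<ge> 0"
    using F_nonneg[OF ray[OF r0]] out0 by blast
  moreover have "F (T (0, 0, 1)) \<ge> 0"
    using F_nonneg[OF ray[OF r1]] out1 by blast
  ultimately have "\<delta>\<^sup>2 \<le> (norm (p - (q, 0)))\<^sup>2"
    by (metis F_add add_nonneg_nonneg diff_ge_0_iff_ge zero_le_mult_iff not_less)
  then show ?thesis
    by (rule power2_le_imp_le) simp
qed

section \<open>Hyperbolic distance\<close>

text \<open>This quantity is \<open>2 cosh d - 2\<close> for the hyperbolic distance \<open>d\<close>.\<close>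

definition hgap :: "quat \<times> real \<Rightarrow> quat \<times> real \<Rightarrow> real" where
  "hgap p p' = (norm (p - p'))\<^sup>2 / (snd p * snd p')"

text \<open>Invariance of the open half-space is built in, so that heights stay positive and the
  property composes.\<close>

definition preserves_hgap :: "(hpoint \<Rightarrow> hpoint) \<Rightarrow> bool" where
  "preserves_hgap f \<longleftrightarrow>
     (\<forall>p p'. snd p > 0 \<longrightarrow> snd p' > 0 \<longrightarrow>
        (\<exists>r r'. f (Some p) = Some r \<and> f (Some p') = Some r' \<and> snd r > 0 \<and> snd r' > 0 \<and>
           hgap r r' = hgap p p'))"

lemma preserves_hgap_compose:
  assumes "preserves_hgap f" "preserves_hgap g"
  shows "preserves_hgap (f \<circ> g)"
  unfolding preserves_hgap_def
proof (intro allI impI)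
  fix p p' :: "quat \<times> real"
  assume "snd p > 0" "snd p' > 0"
  then obtain r r' where r: "g (Some p) = Some r" "g (Some p') = Some r'" "snd r > 0" "snd r' > 0"
    "hgap r r' = hgap p p'"
    using assms(2) unfolding preserves_hgap_def by blast
  then obtain s s' where "f (Some r) = Some s" "f (Some r') = Some s'" "snd s > 0" "snd s' > 0"
    "hgap s s' = hgap r r'"
    using assms(1) unfolding preserves_hgap_def by blast
  with r show "\<exists>s s'. (f \<circ> g) (Some p) = Some s \<and> (f \<circ> g) (Some p') = Some s' \<and> snd s > 0 \<and>
      snd s' > 0 \<and> hgap s s' = hgap p p'"
    by auto
qed

lemma preserves_hgap_translation: "preserves_hgap (mobius_translation w)"
  by (simp add: preserves_hgap_def hgap_def)

text \<open>The classical distortion formula of inversion. The heights of two points are divided by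
  the same squared norms, so these cancel in \<open>hgap\<close>.\<close>

lemma norm_inversion_diff:
  fixes x y :: "'a::real_inner"
  assumes "x \<noteq> 0" "y \<noteq> 0"
  shows "(norm (x /\<^sub>R (norm x)\<^sup>2 - y /\<^sub>R (norm y)\<^sup>2))\<^sup>2 = (norm (x - y))\<^sup>2 / ((norm x)\<^sup>2 * (norm y)\<^sup>2)"
proof -
  have "x \<bullet> x > 0" "y \<bullet> y > 0" using assms by auto
  then show ?thesis
    unfolding power2_norm_eq_inner
    by (simp add: inner_diff_left inner_diff_right inner_commute[of y x] field_simps)
qed

lemma preserves_hgap_inversion: "preserves_hgap (mobius_inversion c)"
proof -
  have "preserves_hgap (mobius_inversion 0)"
    unfolding preserves_hgap_def
  proof (intro allI impI)
    fix p p' :: "quat \<times> real"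
    assume pos: "snd p > 0" "snd p' > 0"
    then have nz: "p \<noteq> 0" "p' \<noteq> 0" by auto
    let ?r = "p /\<^sub>R (norm p)\<^sup>2" and ?r' = "p' /\<^sub>R (norm p')\<^sup>2"
    have "hgap ?r ?r' = hgap p p'"
      unfolding hgap_def norm_inversion_diff[OF nz] using nz pos by (simp add: field_simps)
    then show "\<exists>r r'. mobius_inversion 0 (Some p) = Some r \<and> mobius_inversion 0 (Some p') = Some r' \<and>
        snd r > 0 \<and> snd r' > 0 \<and> hgap r r' = hgap p p'"
      using nz pos by (intro exI[of _ ?r] exI[of _ ?r']) (simp add: mobius_inversion_simps)
  qed
  then show ?thesis
    unfolding mobius_inversion_conj[of c]
    by (intro preserves_hgap_compose preserves_hgap_translation)
qed

text \<open>Points at fixed hyperbolic distance are Euclidean close near the boundary: their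
  distance y satisfies y^2 = C h h' for the heights h and h', and h is small. One
  \<open>\<eta>\<close> serves all points, hence all members of an orbit.\<close>

lemma near_boundary_hgap:
  assumes "\<delta> > 0" "C \<ge> 0"
  shows "\<exists>\<eta>>0. \<forall>p p' q. snd p > 0 \<longrightarrow> snd p' > 0 \<longrightarrow> hgap p p' = C \<longrightarrow> norm (p - (q, 0)) < \<eta> \<longrightarrow>
    norm (p' - (q, 0)) < \<delta>"
proof -
  \<comment> \<open>The first bound contributes at most half of \<open>\<delta>\<close> to the
    triangle inequality at the end; the second gives
    \<open>2 * (C * \<eta>) \<le> \<delta> / 4\<close>, which refutes
    \<open>y \<ge> \<delta> / 2\<close>.\<close>
  define \<eta> where "\<eta> = min (\<delta> / 2) (\<delta> / (8 * (C + 1)))"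
  have \<eta>: "\<eta> > 0" "\<eta> \<le> \<delta> / 2" "C * \<eta> \<le> \<delta> / 8"
  proof -
    have "C * \<eta> \<le> C * (\<delta> / (8 * (C + 1)))"
      using assms by (intro mult_left_mono) (auto simp: \<eta>_def)
    also have "\<dots> \<le> \<delta> / 8"
      using assms by (simp add: field_simps)
    finally show "C * \<eta> \<le> \<delta> / 8" .
    show "\<eta> \<le> \<delta> / 2" unfolding \<eta>_def by (rule min.cobounded1)
  qed (use assms in \<open>auto simp: \<eta>_def\<close>)
  have "norm (p' - (q, 0)) < \<delta>"
    if pos: "snd p > 0" "snd p' > 0" and gap: "hgap p p' = C" and near: "norm (p - (q, 0)) < \<eta>"
    for p p' :: "quat \<times> real" and q
  proof -
    define y where "y = norm (p - p')"
    have t: "snd p < \<eta>"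
      using norm_snd_le[of "snd p" "fst p - q"] near by (cases p) simp
    have t': "snd p' \<le> snd p + y"
      using norm_snd_le[of "snd p - snd p'" "fst p - fst p'"]
      by (cases p; cases p') (simp add: y_def)
    have eq: "y\<^sup>2 = C * (snd p * snd p')"
      using gap pos by (simp add: hgap_def y_def field_simps)
    \<comment> \<open>If \<open>y\<close> were larger, the height of \<open>p'\<close> would be at
      most \<open>2 * y\<close>, so the quadratic \<open>y\<^sup>2\<close> would be bounded by a
      small multiple of \<open>y\<close>.\<close>
    have "y < \<delta> / 2"
    proof (rule ccontr)
      assume "\<not> ?thesis"
      then have y: "\<delta> / 2 \<le> y" by simp
      then have y0: "y > 0" using assms by linarith
      have "snd p' \<le> 2 * y" using t t' \<eta>(2) y by linarith
      then have "snd p * snd p' \<le> \<eta> * (2 * y)"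
        using t pos \<eta>(1) by (intro mult_mono) auto
      then have "y\<^sup>2 \<le> C * (\<eta> * (2 * y))"
        unfolding eq using assms(2) by (rule mult_left_mono)
      then have "y * y \<le> (2 * (C * \<eta>)) * y" by (simp add: power2_eq_square algebra_simps)
      then have "y \<le> 2 * (C * \<eta>)" using y0 by simp
      with y \<eta>(3) assms(1) show False by linarith
    qed
    moreover have "norm (p' - (q, 0)) \<le> norm (p - (q, 0)) + y"
      unfolding y_def using norm_triangle_ineq4[of "p - (q, 0)" "p - p'"] by (simp add: algebra_simps)
    ultimately show ?thesis using near \<eta>(2) by linarith
  qed
  with \<eta>(1) show ?thesis by blast
qed

section \<open>Expanding inversions\<close>

text \<open>
  An inversion centered within distance \<open>r < 1\<close> of the center of a ball, but outside the ball,
  enlarges it by at least \<open>1 / r\<^sup>2\<close>; after finitely many such steps the ball contains a center.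
\<close>

lemma norm_diff_squared:
  fixes x y :: "'a::real_inner"
  shows "(norm (x - y))\<^sup>2 = x \<bullet> x - 2 * (x \<bullet> y) + y \<bullet> y"
  by (simp add: power2_norm_eq_inner inner_diff_left inner_diff_right inner_commute[of y x])

lemma dense_of_expanding_inversions:
  fixes D :: "'a::real_inner set"
  assumes "affine W" "C \<subseteq> W" "C \<subseteq> D" "0 < r" "r < 1"
    and net: "\<And>x. x \<in> W \<Longrightarrow> \<exists>c\<in>C. dist x c \<le> r"
    and inv: "\<And>c y. \<lbrakk>c \<in> C; y \<in> D; y \<noteq> c\<rbrakk> \<Longrightarrow> c + (y - c) /\<^sub>R (norm (y - c))\<^sup>2 \<in> D"
  shows "W \<subseteq> closure D"
proof -
  \<comment> \<open>Induction from large balls to small ones. A ball of radius at least 1 > r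
    contains a net point, which lies in \<open>D\<close>; a smaller ball either contains its nearby
    center or is enlarged by the inversion there.\<close>
  have main: "\<forall>x\<in>W. \<forall>\<rho>. \<rho> > 0 \<and> r ^ m \<le> \<rho> \<longrightarrow> (\<exists>y\<in>D. norm (y - x) < \<rho>)" for m :: nat
  proof (induction m)
    case 0
    have "\<exists>y\<in>D. norm (y - x) < \<rho>" if "x \<in> W" "1 \<le> \<rho>" for x \<rho>
      using net[OF that(1)] that(2) assms(3,5) by (force simp: dist_norm norm_minus_commute)
    then show ?case by simp
  next
    case (Suc m)
    show ?case
    proof (intro ballI allI impI, elim conjE)
      fix x \<rho> assume x: "x \<in> W" and \<rho>: "0 < \<rho>" "r ^ Suc m \<le> \<rho>"
      obtain c where c: "c \<in> C" "dist x c \<le> r" using net[OF x] by blast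
      define d where "d = norm (x - c)"
      have dr: "d \<le> r" using c(2) by (simp add: d_def dist_norm)
      show "\<exists>y\<in>D. norm (y - x) < \<rho>"
      proof (cases "d < \<rho>")
        case True
        then show ?thesis
          using c(1) assms(3) by (auto simp: d_def norm_minus_commute)
      next
        case False
        \<comment> \<open>Shrinking the radius by \<open>r\<close> puts \<open>c\<close> strictly
          outside the closed ball. The inversion at \<open>c\<close> maps this ball to the one of
          center \<open>c + z0\<close> and radius \<open>\<rho>' / k\<close>, where \<open>k\<close>
          is the power of \<open>c\<close>. As \<open>k \<le> r\<^sup>2\<close>, the new radius is
          at least \<open>\<rho> / r\<close>. The new center lies on the line through
          \<open>c\<close> and \<open>x\<close>, hence in \<open>W\<close>.\<close>
        define \<rho>' where "\<rho>' = r * \<rho>"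
        define k where "k = d\<^sup>2 - \<rho>'\<^sup>2"
        define z0 where "z0 = (x - c) /\<^sub>R k"
        have \<rho>': "0 < \<rho>'" "\<rho>' < \<rho>" using \<rho>(1) assms(4,5) by (auto simp: \<rho>'_def)
        have k: "0 < k"
          using False \<rho>' unfolding k_def by (simp add: power_strict_mono)
        have k_le: "k \<le> r\<^sup>2"
          using power_mono[OF dr norm_ge_zero[of "x - c", folded d_def], of 2] zero_le_power2[of \<rho>']
          unfolding k_def by linarith
        have "\<rho> / r \<le> \<rho>' / k"
        proof -
          have "\<rho> / r = \<rho>' / r\<^sup>2" using assms(4) by (simp add: \<rho>'_def power2_eq_square)
          also have "\<dots> \<le> \<rho>' / k" using k k_le \<rho>'(1) assms(4) by (intro divide_left_mono mult_pos_pos) auto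
          finally show ?thesis .
        qed
        moreover have "r ^ m \<le> \<rho> / r"
          using \<rho>(2) assms(4) by (simp add: field_simps)
        ultimately have "r ^ m \<le> \<rho>' / k" "0 < \<rho>' / k"
          using \<rho>'(1) k by auto
        moreover have "c + z0 \<in> W"
        proof -
          have "(1 - inverse k) *\<^sub>R c + inverse k *\<^sub>R x \<in> W"
            using assms(1,2) c(1) x by (intro mem_affine) auto
          moreover have "c + z0 = (1 - inverse k) *\<^sub>R c + inverse k *\<^sub>R x"
            unfolding z0_def scaleR_diff_left scaleR_diff_right by simp
          ultimately show ?thesis by simp
        qed
        ultimately obtain y where y: "y \<in> D" "norm (y - (c + z0)) < \<rho>' / k"
          using Suc.IH by blast
        define z where "z = y - c"
        define w where "w = z /\<^sub>R (norm z)\<^sup>2"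
        have xc: "(x - c) \<bullet> (x - c) = k + \<rho>'\<^sup>2"
          by (simp add: k_def d_def power2_norm_eq_inner)
        have "(norm (z - z0))\<^sup>2 < (\<rho>' / k)\<^sup>2"
          using y(2) by (intro power_strict_mono) (auto simp: z_def algebra_simps)
        then have "z \<bullet> z - 2 * (z \<bullet> (x - c)) / k + (k + \<rho>'\<^sup>2) / k\<^sup>2 < \<rho>'\<^sup>2 / k\<^sup>2"
          unfolding norm_diff_squared z0_def
          by (simp add: xc power2_eq_square[of k] power2_eq_square[of "\<rho>' * inverse k"] power2_eq_square[of \<rho>']
              divide_inverse mult.assoc mult.commute mult.left_commute)
        then have "k\<^sup>2 * (z \<bullet> z - 2 * (z \<bullet> (x - c)) / k + (k + \<rho>'\<^sup>2) / k\<^sup>2) < k\<^sup>2 * (\<rho>'\<^sup>2 / k\<^sup>2)"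
          using k by (intro mult_strict_left_mono) auto
        moreover have "k\<^sup>2 * (\<alpha> - 2 * \<beta> / k + (k + \<rho>'\<^sup>2) / k\<^sup>2) = k * (k * \<alpha> - 2 * \<beta> + 1) + \<rho>'\<^sup>2" for \<alpha> \<beta>
          using k by (simp add: field_simps power2_eq_square)
        ultimately have "k * (k * (z \<bullet> z) - 2 * (z \<bullet> (x - c)) + 1) < 0"
          using k by simp
        \<comment> \<open>This is membership of \<open>z\<close> in the enlarged ball, cleared of
          denominators. Dividing by |z|^2 will turn it into membership of \<open>w\<close> in the
          shrunken ball; z = 0 is excluded because it would give 1 < 0.\<close>
        then have ineq: "k * (z \<bullet> z) - 2 * (z \<bullet> (x - c)) + 1 < 0"
          using mult_nonneg_nonneg[OF less_imp_le[OF k]] by (meson not_less)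
        then have z: "z \<noteq> 0" by auto
        then have zz: "z \<bullet> z > 0" by simp
        have "w \<bullet> w - 2 * (w \<bullet> (x - c)) + k = (k * (z \<bullet> z) - 2 * (z \<bullet> (x - c)) + 1) / (z \<bullet> z)"
        proof -
          have "w \<bullet> w = 1 / (z \<bullet> z)" "w \<bullet> (x - c) = (z \<bullet> (x - c)) / (z \<bullet> z)"
            using zz by (simp_all add: w_def power2_norm_eq_inner divide_inverse mult.commute)
          then show ?thesis
            using zz by (simp add: diff_divide_distrib add_divide_distrib)
        qed
        also have "\<dots> < 0" using ineq zz by (rule divide_neg_pos)
        finally have "(norm (w - (x - c)))\<^sup>2 < \<rho>'\<^sup>2"
          unfolding norm_diff_squared xc by simp
        then have "norm (w - (x - c)) < \<rho>'"
          using \<rho>'(1) by (meson less_imp_le power_less_imp_less_base)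
        then have "norm (c + w - x) < \<rho>"
          using \<rho>'(2) by (metis diff_diff_eq2 add.commute less_trans)
        moreover have "c + w \<in> D"
          using inv[OF c(1) y(1)] z by (simp add: w_def z_def)
        ultimately show ?thesis by blast
      qed
    qed
  qed
  show ?thesis
  proof
    fix x assume x: "x \<in> W"
    show "x \<in> closure D"
      unfolding closure_approachable
    proof (intro allI impI)
      fix e :: real assume "e > 0"
      obtain m where "r ^ m < e"
        using real_arch_pow_inv[OF \<open>e > 0\<close> assms(5)] by blast
      then show "\<exists>y\<in>D. dist y x < e"
        using main[of m] x \<open>e > 0\<close> by (auto simp: dist_norm)
    qed
  qed
qed

text \<open>Subtracting a suitable point of \<open>L\<close> moves any point of \<open>S\<close>
  into the compact unit ball of \<open>S\<close>, and \<open>L\<close> absorbs the shift. There the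
  distance to \<open>L\<close> attains its maximum, which the covering by open balls keeps below
  1.\<close>

lemma uniform_net_radius:
  fixes L S :: "'a::euclidean_space set"
  assumes "subspace S" "L \<subseteq> S" "0 \<in> L" and add: "\<And>a b. a \<in> L \<Longrightarrow> b \<in> L \<Longrightarrow> a + b \<in> L"
    and cover: "S \<subseteq> (\<Union>c\<in>L. ball c 1)"
  obtains r where "0 < r" "r < 1" "\<And>x. x \<in> S \<Longrightarrow> \<exists>c\<in>L. dist x c \<le> r"
proof -
  define K where "K = S \<inter> cball 0 1"
  have "compact K"
    using closed_subspace[OF assms(1)] by (simp add: K_def closed_Int_compact)
  moreover have "K \<noteq> {}"
    using subspace_0[OF assms(1)] by (auto simp: K_def)
  moreover have "continuous_on K (\<lambda>x. infdist x L)"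
    by (intro continuous_intros)
  ultimately obtain x0 where x0: "x0 \<in> K" "\<And>y. y \<in> K \<Longrightarrow> infdist y L \<le> infdist x0 L"
    by (metis continuous_attains_sup)
  obtain c0 where "c0 \<in> L" "dist x0 c0 < 1"
    using cover x0(1) by (auto simp: K_def dist_commute)
  then have m: "infdist x0 L < 1"
    using infdist_le[of c0 L x0] by linarith
  \<comment> \<open>The infimum in \<open>infdist\<close> need not be attained; a radius strictly
    between the maximum and 1 leaves room for an actual point of \<open>L\<close>.\<close>
  define r where "r = (infdist x0 L + 1) / 2"
  have "\<exists>c\<in>L. dist x c \<le> r" if x: "x \<in> S" for x
  proof -
    obtain c where c: "c \<in> L" "dist x c < 1"
      using cover x by (auto simp: dist_commute)
    have "x - c \<in> K"
      using c assms(2) x subspace_diff[OF assms(1)] by (auto simp: K_def dist_norm norm_minus_commute)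
    then have "infdist (x - c) L < r"
      using x0(2) m by (force simp: r_def)
    then obtain c' where "c' \<in> L" "dist (x - c) c' < r"
    proof -
      have "L \<noteq> {}" using assms(3) by auto
      moreover have "bdd_below (dist (x - c) ` L)"
        by (intro bdd_belowI2[of _ 0]) simp
      ultimately show ?thesis
        using \<open>infdist (x - c) L < r\<close> that by (auto simp: infdist_notempty cINF_less_iff)
    qed
    then show ?thesis
      using add c(1) by (intro bexI[of _ "c + c'"]) (auto simp: dist_norm algebra_simps)
  qed
  moreover have "0 < r" "r < 1"
    using m infdist_nonneg[of x0 L] by (auto simp: r_def)
  ultimately show ?thesis using that by blast
qed

section \<open>The group\<close>

lemma generate_BijGroup_UNIV_compose:
  assumes "H \<subseteq> {f. bij f}" "f \<in> generate (BijGroup UNIV) H" "g \<in> generate (BijGroup UNIV) H"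
  shows "f \<otimes>\<^bsub>BijGroup UNIV\<^esub> g = f \<circ> g"
proof -
  have "H \<subseteq> carrier (BijGroup UNIV)"
    using assms(1) by (auto simp: BijGroup_def Bij_def)
  then have "f \<in> carrier (BijGroup UNIV)" "g \<in> carrier (BijGroup UNIV)"
    using assms(2,3) by (auto intro: group.generate_in_carrier[OF group_BijGroup])
  then show ?thesis
    by (simp add: BijGroup_def compose_def fun_eq_iff)
qed

text \<open>The generators are closed under inverses, so the inverse case of \<open>generate\<close>
  merges into the generator case.\<close>

lemma generate_BijGroup_UNIV_induct [consumes 1, case_names inverse id gen compose]:
  assumes "f \<in> generate (BijGroup UNIV) H"
    and "\<And>h. h \<in> H \<Longrightarrow> \<exists>h'\<in>H. h' \<circ> h = id \<and> h \<circ> h' = id"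
    and "P id" and "\<And>h. h \<in> H \<Longrightarrow> P h" and "\<And>f g. P f \<Longrightarrow> P g \<Longrightarrow> P (f \<circ> g)"
  shows "P f"
proof -
  have H: "H \<subseteq> {f. bij f}"
    using assms(2) o_bij by blast
  show ?thesis
    using assms(1)
  proof (induction rule: generate.induct)
    case one
    then show ?case using assms(3) by (simp add: BijGroup_def id_def restrict_UNIV)
  next
    case (incl h)
    then show ?case by (rule assms(4))
  next
    case (inv h)
    then obtain h' where h': "h' \<in> H" "h' \<circ> h = id" "h \<circ> h' = id" using assms(2) by blast
    have "h \<in> Bij UNIV" using H inv by (auto simp: Bij_def)
    then have "inv\<^bsub>BijGroup UNIV\<^esub> h = inv_into UNIV h"
      by (simp add: inv_BijGroup restrict_UNIV)
    also have "\<dots> = h'" using h'(2,3) by (metis inv_unique_comp)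
    finally show ?case using assms(4) h'(1) by simp
  next
    case (eng f g)
    then show ?case
      using generate_BijGroup_UNIV_compose[OF H] assms(5) by metis
  qed
qed

text \<open>\<open>V\<close> stands for the finite boundary, \<open>S\<close> for the hyperplane,
  \<open>L\<close> and \<open>M\<close> for the inversion centers on \<open>S\<close> and on its
  translate. The vector \<open>e\<close> provides a translation of infinite order.\<close>

locale strip_group =
  fixes V S L M :: "quat set" and \<tau> e :: quat
  assumes subspace_V: "subspace V" and subspace_S: "subspace S" and S_V: "S \<subseteq> V"
    and L_S: "L \<subseteq> S" and L_0: "0 \<in> L"
    and L_diff: "\<And>a b. a \<in> L \<Longrightarrow> b \<in> L \<Longrightarrow> a - b \<in> L"
    and L_cover: "S \<subseteq> (\<Union>c\<in>L. ball c 1)"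
    and L_nontrivial: "e \<in> L" "e \<noteq> 0"
    and \<tau>_V: "\<tau> \<in> V" and L_M: "(\<lambda>x. x + \<tau>) ` L \<subseteq> M" and M_V: "M \<subseteq> V"
begin

definition \<Gamma> :: "(hpoint \<Rightarrow> hpoint) set" where
  "\<Gamma> = generate (BijGroup UNIV) (mobius_translation ` L \<union> mobius_inversion ` L \<union> mobius_inversion ` M)"

text \<open>The union of the packing with orientations forgotten; both generating planes pass
  through infinity.\<close>

definition \<Lambda> :: "hpoint set" where
  "\<Lambda> = (\<Union>g\<in>\<Gamma>. g ` insert None (boundary_point ` (S \<union> (\<lambda>x. x + \<tau>) ` S)))"

lemma L_minus: "a \<in> L \<Longrightarrow> - a \<in> L"
  using L_diff[OF L_0] by simp

lemma L_add: "a \<in> L \<Longrightarrow> b \<in> L \<Longrightarrow> a + b \<in> L"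
  using L_diff[of a "- b"] L_minus by simp

lemma generator_inverse:
  assumes "h \<in> mobius_translation ` L \<union> mobius_inversion ` L \<union> mobius_inversion ` M"
  shows "\<exists>h'\<in>mobius_translation ` L \<union> mobius_inversion ` L \<union> mobius_inversion ` M. h' \<circ> h = id \<and> h \<circ> h' = id"
  using assms
proof (elim UnE)
  assume "h \<in> mobius_translation ` L"
  then obtain w where "w \<in> L" "h = mobius_translation w" by blast
  then show ?thesis
    using L_minus mobius_translation_inverse by (intro bexI[of _ "mobius_translation (- w)"]) auto
qed (use mobius_inversion_inverse in \<open>(intro bexI[of _ h], auto)\<close>)

lemma \<Gamma>_induct [consumes 1, case_names id translation inversion compose]:
  assumes "g \<in> \<Gamma>" "P id" "\<And>w. w \<in> V \<Longrightarrow> P (mobius_translation w)"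
    and "\<And>c. c \<in> V \<Longrightarrow> P (mobius_inversion c)" "\<And>f g. P f \<Longrightarrow> P g \<Longrightarrow> P (f \<circ> g)"
  shows "P g"
  using assms(1) unfolding \<Gamma>_def
proof (induction rule: generate_BijGroup_UNIV_induct)
  case (gen h)
  then show ?case
    using assms(3,4) L_S S_V M_V by blast
qed (fact generator_inverse assms(2,5))+

lemma \<Gamma>_translation: "w \<in> L \<Longrightarrow> mobius_translation w \<in> \<Gamma>"
  unfolding \<Gamma>_def by (intro generate.incl) auto

lemma \<Gamma>_inversion: "c \<in> L \<union> M \<Longrightarrow> mobius_inversion c \<in> \<Gamma>"
  unfolding \<Gamma>_def by (intro generate.incl) auto

lemma \<Gamma>_id: "id \<in> \<Gamma>"
  using \<Gamma>_translation[OF L_0] by simp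

lemma \<Gamma>_compose:
  assumes "f \<in> \<Gamma>" "g \<in> \<Gamma>"
  shows "f \<circ> g \<in> \<Gamma>"
proof -
  let ?H = "mobius_translation ` L \<union> mobius_inversion ` L \<union> mobius_inversion ` M"
  have "?H \<subseteq> {f. bij f}"
    using generator_inverse o_bij by blast
  then have "f \<otimes>\<^bsub>BijGroup UNIV\<^esub> g = f \<circ> g"
    using assms generate_BijGroup_UNIV_compose unfolding \<Gamma>_def by blast
  then show ?thesis
    using generate.eng[of f "BijGroup UNIV" ?H g] assms unfolding \<Gamma>_def by simp
qed

section \<open>Properties inherited by all group elements\<close>

lemma continuous_\<Gamma>: "g \<in> \<Gamma> \<Longrightarrow> continuous_map hpoint_topology hpoint_topology g"
proof (induction rule: \<Gamma>_induct)
  case (compose f g)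
  then show ?case using continuous_map_compose by blast
qed (simp_all add: continuous_mobius_translation continuous_mobius_inversion)

lemma lifts_linearly_\<Gamma>: "g \<in> \<Gamma> \<Longrightarrow> lifts_linearly g"
proof (induction rule: \<Gamma>_induct)
  case id
  show ?case using lifts_linearly_translation[of 0] unfolding mobius_translation_zero .
qed (blast intro: lifts_linearly_translation lifts_linearly_inversion lifts_linearly_compose)+

lemma preserves_hgap_\<Gamma>: "g \<in> \<Gamma> \<Longrightarrow> preserves_hgap g"
proof (induction rule: \<Gamma>_induct)
  case id
  show ?case using preserves_hgap_translation[of 0] unfolding mobius_translation_zero .
qed (blast intro: preserves_hgap_translation preserves_hgap_inversion preserves_hgap_compose)+

lemma boundary_\<Gamma>: "g \<in> \<Gamma> \<Longrightarrow> g ` hyp_boundary V \<subseteq> hyp_boundary V"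
proof (induction rule: \<Gamma>_induct)
  case (translation w)
  then show ?case
    by (simp add: hyp_boundary_def image_subset_iff mobius_translation_boundary_point
        subspace_add[OF subspace_V])
next
  case (inversion c)
  have "mobius_inversion c (boundary_point y) \<in> hyp_boundary V" if "y \<in> V" for y
  proof (cases "y = c")
    case True
    then show ?thesis by (simp add: mobius_inversion_def boundary_point_def hyp_boundary_def)
  next
    case False
    have "c + (y - c) /\<^sub>R (norm (y - c))\<^sup>2 \<in> V"
      using subspace_V inversion that by (intro subspace_add subspace_scale subspace_diff)
    then show ?thesis
      using False by (simp add: mobius_inversion_boundary_point hyp_boundary_def)
  qed
  moreover have "mobius_inversion c None \<in> hyp_boundary V"
    using inversion by (simp add: mobius_inversion_def hyp_boundary_def boundary_point_def)
  ultimately show ?case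
    unfolding hyp_boundary_def by (simp add: image_subset_iff)
next
  case (compose f g)
  then show ?case unfolding image_comp[symmetric] by blast
qed simp

lemma \<Lambda>_boundary: "\<Lambda> \<subseteq> hyp_boundary V"
proof -
  have "insert None (boundary_point ` (S \<union> (\<lambda>x. x + \<tau>) ` S)) \<subseteq> hyp_boundary V"
    unfolding hyp_boundary_def using S_V subspace_add[OF subspace_V _ \<tau>_V] by blast
  then show ?thesis
    unfolding \<Lambda>_def using boundary_\<Gamma> by blast
qed

text \<open>The closure is taken in the whole point type, while limit points must lie in
  \<open>hyp_boundary V\<close>; the finite-dimensional subspace \<open>V\<close> is closed, so
  nothing is added outside.\<close>

lemma closure_\<Lambda>_boundary: "hpoint_topology closure_of \<Lambda> \<subseteq> hyp_boundary V"
proof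
  fix Q assume Q: "Q \<in> hpoint_topology closure_of \<Lambda>"
  show "Q \<in> hyp_boundary V"
  proof (cases Q)
    case (Some p)
    have "Some -` \<Lambda> \<subseteq> V \<times> {0}"
      using \<Lambda>_boundary by (auto simp: hyp_boundary_def boundary_point_def)
    moreover have "closed (V \<times> {0::real})"
      using closed_subspace[OF subspace_V] by (intro closed_Times) auto
    ultimately have "closure (Some -` \<Lambda>) \<subseteq> V \<times> {0}"
      by (rule closure_minimal)
    then show ?thesis
      using Q Some by (auto simp: Some_in_closure_hpoint hyp_boundary_def boundary_point_def)
  qed (simp add: hyp_boundary_def)
qed

section \<open>From the packing to limit points\<close>

lemma None_in_orbit_closure:
  "None \<in> hpoint_topology closure_of {g (Some (x, t)) | g. g \<in> \<Gamma>}"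
proof -
  let ?A = "{g (Some (x, t)) | g. g \<in> \<Gamma>}"
  \<comment> \<open>Translations by the multiples of \<open>e\<close> carry any point beyond every
    bound.\<close>
  have eL: "of_nat m *\<^sub>R e \<in> L" for m
    by (induction m) (simp_all add: L_0 L_nontrivial L_add scaleR_add_left)
  have "\<not> bounded (Some -` ?A)"
  proof
    assume "bounded (Some -` ?A)"
    then obtain B where B: "\<And>p. Some p \<in> ?A \<Longrightarrow> norm p \<le> B"
      by (auto simp: bounded_iff)
    have le: "of_nat m * norm e \<le> B + norm x" for m
    proof -
      have "Some (x + of_nat m *\<^sub>R e, t) \<in> ?A"
        using \<Gamma>_translation[OF eL[of m]]
        by (intro CollectI exI[of _ "mobius_translation (of_nat m *\<^sub>R e)"]) simp
      then have "norm (x + of_nat m *\<^sub>R e) \<le> B"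
        using B norm_fst_le order_trans by blast
      then show ?thesis
        using norm_triangle_ineq4[of "x + of_nat m *\<^sub>R e" x] by simp
    qed
    obtain m where "(B + norm x) / norm e < of_nat m"
      using reals_Archimedean2 by blast
    then show False
      using le[of m] L_nontrivial by (simp add: field_simps)
  qed
  then show ?thesis
    by (simp add: None_in_closure_hpoint)
qed

text \<open>The orbit closure \<open>K\<close> is invariant because group elements are continuous.
  It contains infinity, hence every inversion center, hence both generating planes by the expansion
  argument; invariance then spreads this to the whole packing.\<close>

lemma closure_\<Lambda>_subset_orbit_closure:
  "hpoint_topology closure_of \<Lambda> \<subseteq> hpoint_topology closure_of {g (Some (x, t)) | g. g \<in> \<Gamma>}"
proof -
  let ?A = "{g (Some (x, t)) | g. g \<in> \<Gamma>}"
  define K where "K = hpoint_topology closure_of ?A"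
  have closed_K: "closedin hpoint_topology K" by (simp add: K_def)
  have None_K: "None \<in> K" unfolding K_def by (rule None_in_orbit_closure)
  have inv_K: "g P \<in> K" if "g \<in> \<Gamma>" "P \<in> K" for g P
  proof -
    have "g ` ?A \<subseteq> ?A"
      using \<Gamma>_compose[OF that(1)] by (force simp: comp_def)
    then have "hpoint_topology closure_of (g ` ?A) \<subseteq> K"
      unfolding K_def by (rule closure_of_mono)
    moreover have "g ` K \<subseteq> hpoint_topology closure_of (g ` ?A)"
      unfolding K_def by (rule continuous_map_image_closure_subset[OF continuous_\<Gamma>[OF that(1)]])
    ultimately show ?thesis using that(2) by blast
  qed
  define D where "D = {y. boundary_point y \<in> K}"
  have "closed D"
  proof -
    have "D = (\<lambda>y. (y, 0)) -` (Some -` K)" by (auto simp: D_def boundary_point_def)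
    moreover have "closed (Some -` K)" by (rule closedin_hpoint_topology_vimage[OF closed_K])
    ultimately show ?thesis
      by (simp add: closed_vimage continuous_intros)
  qed
  obtain r where r: "0 < r" "r < 1" "\<And>x. x \<in> S \<Longrightarrow> \<exists>c\<in>L. dist x c \<le> r"
    using uniform_net_radius[OF subspace_S L_S L_0 L_add L_cover] by blast
  \<comment> \<open>Treats both planes at once, with \<open>\<sigma>\<close> equal to 0 or
    \<open>\<tau>\<close>; translation preserves the net radius.\<close>
  have dense: "(\<lambda>x. x + \<sigma>) ` S \<subseteq> D" if \<sigma>: "(\<lambda>x. x + \<sigma>) ` L \<subseteq> L \<union> M" for \<sigma>
  proof -
    have "(\<lambda>x. x + \<sigma>) ` S \<subseteq> closure D"
    proof (rule dense_of_expanding_inversions[OF _ _ _ r(1,2)])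
      show "affine ((\<lambda>x. x + \<sigma>) ` S)"
        using affine_translation[of S \<sigma>] subspace_imp_affine[OF subspace_S] by (simp add: add.commute)
      show "(\<lambda>x. x + \<sigma>) ` L \<subseteq> (\<lambda>x. x + \<sigma>) ` S" using L_S by blast
      show "(\<lambda>x. x + \<sigma>) ` L \<subseteq> D"
      proof
        fix c assume "c \<in> (\<lambda>x. x + \<sigma>) ` L"
        then have "mobius_inversion c \<in> \<Gamma>" using \<sigma> \<Gamma>_inversion by blast
        then have "mobius_inversion c None \<in> K" using inv_K None_K by blast
        then show "c \<in> D" by (simp add: D_def mobius_inversion_def boundary_point_def)
      qed
      show "\<exists>c\<in>(\<lambda>x. x + \<sigma>) ` L. dist x c \<le> r" if "x \<in> (\<lambda>x. x + \<sigma>) ` S" for x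
        using that r(3) by force
      show "c + (y - c) /\<^sub>R (norm (y - c))\<^sup>2 \<in> D"
        if "c \<in> (\<lambda>x. x + \<sigma>) ` L" "y \<in> D" "y \<noteq> c" for c y
      proof -
        have "mobius_inversion c \<in> \<Gamma>" using that(1) \<sigma> \<Gamma>_inversion by blast
        then have "mobius_inversion c (boundary_point y) \<in> K"
          using that(2) inv_K by (simp add: D_def)
        then show ?thesis
          using that(3) by (simp add: mobius_inversion_boundary_point D_def)
      qed
    qed
    then show ?thesis using \<open>closed D\<close> by simp
  qed
  have "S \<subseteq> D" using dense[of 0] by simp
  moreover have "(\<lambda>x. x + \<tau>) ` S \<subseteq> D" using dense[of \<tau>] L_M by blast
  ultimately have "insert None (boundary_point ` (S \<union> (\<lambda>x. x + \<tau>) ` S)) \<subseteq> K"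
    using None_K by (auto simp: D_def)
  then have "\<Lambda> \<subseteq> K" unfolding \<Lambda>_def using inv_K by blast
  then show ?thesis
    using closure_of_minimal[OF _ closed_K] by (simp add: K_def)
qed

lemma closure_\<Lambda>_subset_limit_set: "hpoint_topology closure_of \<Lambda> \<subseteq> limit_set V \<Gamma>"
proof
  fix Q assume Q: "Q \<in> hpoint_topology closure_of \<Lambda>"
  from closure_hpoint_sequential[OF subsetD[OF closure_\<Lambda>_subset_orbit_closure[of 0 1] Q]]
  obtain f where f: "\<And>i::nat. f i \<in> {g (Some (0, 1)) | g. g \<in> \<Gamma>}"
    "limitin hpoint_topology f Q sequentially"
    by blast
  have "\<exists>g. g \<in> \<Gamma> \<and> f i = g (Some (0, 1))" for i
    using f(1)[of i] by blast
  then obtain g where g: "\<And>i. g i \<in> \<Gamma>" "\<And>i. f i = g i (Some (0, 1))"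
    by metis
  then have "f = (\<lambda>i. g i (Some (0, 1)))" by blast
  moreover have "Some (0, 1) \<in> hyp_space V"
    unfolding hyp_space_def using subspace_0[OF subspace_V] zero_less_one by blast
  moreover have "Q \<in> hyp_boundary V" using Q closure_\<Lambda>_boundary by blast
  ultimately show "Q \<in> limit_set V \<Gamma>"
    unfolding limit_set_def using f(2) g(1) by blast
qed

section \<open>From limit points to the packing\<close>

lemma limit_set_subset_closure_\<Lambda>: "limit_set V \<Gamma> \<subseteq> hpoint_topology closure_of \<Lambda>"
proof
  fix Q assume "Q \<in> limit_set V \<Gamma>"
  then obtain P g where Q: "Q \<in> hyp_boundary V" and P: "P \<in> hyp_space V"
    and g: "\<And>i::nat. g i \<in> \<Gamma>" "limitin hpoint_topology (\<lambda>i. g i P) Q sequentially"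
    unfolding limit_set_def by blast
  have orbit: "h None \<in> \<Lambda>" "h (Some 0) \<in> \<Lambda>" if "h \<in> \<Gamma>" for h
    using that subspace_0[OF subspace_S]
    by (auto simp: \<Lambda>_def boundary_point_def zero_prod_def)
  show "Q \<in> hpoint_topology closure_of \<Lambda>"
  proof (cases Q)
    case None
    then show ?thesis
      using orbit(1)[OF \<Gamma>_id] by (simp add: None_in_closure_hpoint)
  next
    case (Some q')
    then obtain q where q: "Q = Some (q, 0)"
      using Q by (auto simp: hyp_boundary_def boundary_point_def)
    obtain p where p: "P = Some p" "snd p > 0"
      using P by (auto simp: hyp_space_def)
    have "(q, 0) \<in> closure (Some -` \<Lambda>)"
      unfolding closure_approachable
    proof (intro allI impI)
      fix \<delta> :: real assume \<delta>: "\<delta> > 0"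
      \<comment> \<open>Every group element preserves this gap, so the base point \<open>P\<close>
        can be traded for (0, 1) with one \<open>\<eta>\<close> for the whole sequence.\<close>
      define C where "C = hgap p (0, 1)"
      have C: "C \<ge> 0" using p(2) by (simp add: C_def hgap_def)
      obtain \<eta> where \<eta>: "\<eta> > 0"
        "\<And>p p' q. \<lbrakk>snd p > 0; snd p' > 0; hgap p p' = C; norm (p - (q, 0)) < \<eta>\<rbrakk> \<Longrightarrow> norm (p' - (q, 0)) < \<delta>"
        using near_boundary_hgap[OF \<delta> C] by blast
      have "openin hpoint_topology (Some ` ball (q, 0) \<eta>)"
        by (simp add: hpoint_topology_def)
      moreover have "Q \<in> Some ` ball (q, 0) \<eta>"
        using q \<eta>(1) by simp
      ultimately obtain i where i: "g i P \<in> Some ` ball (q, 0) \<eta>"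
        using g(2) unfolding limitin_def eventually_sequentially by blast
      obtain r r' where r: "g i P = Some r" "g i (Some (0, 1)) = Some r'" "snd r > 0" "snd r' > 0"
        "hgap r r' = C"
      proof -
        have "snd (0 :: quat, 1 :: real) > 0" by simp
        with preserves_hgap_\<Gamma>[OF g(1)[of i]] p(2) show ?thesis
          using that unfolding preserves_hgap_def C_def p(1) by blast
      qed
      have "norm (r - (q, 0)) < \<eta>"
      proof -
        have "r \<in> ball (q, 0) \<eta>" using i r(1) by (metis imageE option.inject)
        then show ?thesis unfolding mem_ball by (metis dist_norm dist_commute)
      qed
      then have lt: "norm (r' - (q, 0)) < \<delta>"
        using \<eta>(2) r by blast
      show "\<exists>y\<in>Some -` \<Lambda>. dist y (q, 0) < \<delta>"
      proof (rule ccontr)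
        assume "\<not> ?thesis"
        then have far: "\<delta> \<le> norm (y - (q, 0))" if "Some y \<in> \<Lambda>" for y
          using that by (force simp: dist_norm)
        \<comment> \<open>Both ends of the image of the geodesic from 0 to infinity lie in
          \<open>\<Lambda>\<close>, hence outside the ball, and so does the point between
          them.\<close>
        have "\<delta> \<le> norm (r' - (q, 0))"
        proof (rule geodesic_outside_ball[OF lifts_linearly_\<Gamma>[OF g(1)[of i]] \<delta> _ _ r(2)])
          show "\<delta> \<le> norm (y - (q, 0))" if "g i (Some 0) = Some y" for y
            using far orbit(2)[OF g(1)[of i]] that by simp
          show "\<delta> \<le> norm (y - (q, 0))" if "g i None = Some y" for y
            using far orbit(1)[OF g(1)[of i]] that by simp
        qed
        with lt show False by simp
      qed
    qed
    then show ?thesis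
      by (simp add: q Some_in_closure_hpoint)
  qed
qed

end

section \<open>The arithmetic rings\<close>

lemma one_in_integral_ring:
  assumes "integral_ring n R"
  shows "qone \<in> plus_part n R"
proof -
  have "(1, 0) \<in> quadratic_integers d" for d
  proof -
    have "1 = of_rat 1 + of_rat 0 * csqrt (of_int d)" by simp
    then have "1 \<in> quadratic_field d" unfolding quadratic_field_def by blast
    then show ?thesis by (simp add: quadratic_integers_def)
  qed
  then have "qone \<in> R"
    using assms by (auto simp: integral_ring_def qone_def maximal_order_def maximal_dagger_order_def
        dagger_order_def quat_order_def)
  then show ?thesis
    by (simp add: plus_part_def qdag_def qone_def)
qed

text \<open>Covering vectors refer to centers in \<open>R\<close>, the group to centers in
  \<open>plus_part n R\<close>. In dimension 4 the real span consists of points fixed by the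
  involution, so the two kinds of centers on the hyperplane agree.\<close>

lemma integral_Int_real_plus: "R \<inter> real_plus n R \<subseteq> plus_part n R"
proof (cases "n = 4")
  case True
  have "subspace {q. qdag q = q}"
    by (auto simp: subspace_def qdag_def complex_eq_iff prod_eq_iff)
  moreover have "plus_part n R \<subseteq> {q. qdag q = q}"
    using True by (auto simp: plus_part_def)
  ultimately have "real_plus n R \<subseteq> {q. qdag q = q}"
    unfolding real_plus_def by (rule span_minimal[rotated])
  then show ?thesis
    using True by (auto simp: plus_part_def)
qed (simp add: plus_part_def)

theorem theorem5p6:
  fixes n :: nat and R :: "quat set" and u \<tau> :: quat
  assumes "integral_ring n R"
    and "normalized_covering_vector n R u"
    and "nrm u > 3"
    and "transversal_vector n R u \<tau>"
  shows "limit_set (real_plus n R) (Gamma_group n R u \<tau>) =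
         hpoint_topology closure_of (\<Union>S \<in> packing n R u \<tau>. fst S)"
proof -
  define V where "V = real_plus n R"
  define S where "S = hplane n R u"
  define L where "L = plus_part n R \<inter> S"
  define M where "M = plus_part n R \<inter> (\<lambda>x. x + \<tau>) ` S"
  have VP: "plus_part n R \<subseteq> V"
    unfolding V_def real_plus_def by (rule span_superset)
  have sub_V: "subspace V" by (simp add: V_def real_plus_def)
  then have sub_S: "subspace S"
    by (auto simp: S_def hplane_def V_def subspace_def inner_add_right)
  have \<tau>: "\<tau> \<in> plus_part n R"
    and closure: "group_closure (insert \<tau> (hplane n R u \<inter> plus_part n R)) = plus_part n R"
    using assms(4) by (auto simp: transversal_vector_def)
  \<comment> \<open>The additive structure is read off the generation by \<open>\<tau>\<close> and
    the hyperplane part, uniformly for the three kinds of rings.\<close>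
  have diff: "a - b \<in> plus_part n R" if "a \<in> plus_part n R" "b \<in> plus_part n R" for a b
    using that group_closure.diff closure by metis
  have add: "a + b \<in> plus_part n R" if "a \<in> plus_part n R" "b \<in> plus_part n R" for a b
    using that group_closure_add closure by metis
  have zero: "0 \<in> plus_part n R"
    using zero_in_group_closure closure by metis
  have cov: "covering_vector n R u"
    using assms(2) by (simp add: normalized_covering_vector_def)
  interpret strip_group V S L M \<tau> qone
  proof
    show "S \<subseteq> V" by (auto simp: S_def V_def hplane_def)
    show "a - b \<in> L" if "a \<in> L" "b \<in> L" for a b
      using that diff subspace_diff[OF sub_S] by (auto simp: L_def)
    have "hplane n R u \<inter> R \<subseteq> L"
      using integral_Int_real_plus[of R n] by (auto simp: L_def S_def hplane_def)
    then show "S \<subseteq> (\<Union>c\<in>L. ball c 1)"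
      using cov unfolding covering_vector_def S_def by blast
    \<comment> \<open>Real part 0 means that \<open>u\<close> is orthogonal to 1, so 1 can serve as
      the nonzero translation vector \<open>e\<close>.\<close>
    have "u \<bullet> qone = 0"
      using cov by (simp add: covering_vector_def qRe_def qone_def inner_prod_def inner_complex_def)
    then show "qone \<in> L"
      using one_in_integral_ring[OF assms(1)] VP by (auto simp: L_def S_def hplane_def V_def)
    show "(\<lambda>x. x + \<tau>) ` L \<subseteq> M"
      unfolding L_def M_def using add[OF _ \<tau>] by blast
  qed (use sub_V sub_S VP \<tau> zero subspace_0[OF sub_S] in \<open>auto simp: L_def M_def qone_def prod_eq_iff\<close>)
  have \<Gamma>: "Gamma_group n R u \<tau> = \<Gamma>"
    unfolding Gamma_group_def \<Gamma>_def by (simp add: L_def M_def S_def)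
  have "(\<Union>S \<in> packing n R u \<tau>. fst S) = \<Lambda>"
  proof -
    \<comment> \<open>Reversal leaves the underlying point set alone, so the second orbit
      contributes the images of the translated plane.\<close>
    have "(\<Union>S \<in> packing n R u \<tau>. fst S) =
        (\<Union>g\<in>\<Gamma>. g ` insert None (boundary_point ` S)) \<union>
        (\<Union>g\<in>\<Gamma>. g ` mobius_translation \<tau> ` insert None (boundary_point ` S))"
      unfolding packing_def \<Gamma>
      by (simp add: Setcompr_eq_image UN_Un osphere_image_def osphere_reverse_def S_sphere_def S_def)
    moreover have "mobius_translation \<tau> ` insert None (boundary_point ` S) =
        insert None (boundary_point ` (\<lambda>x. x + \<tau>) ` S)"
      by (simp add: image_image mobius_translation_boundary_point)
    moreover have "insert None (boundary_point ` (S \<union> (\<lambda>x. x + \<tau>) ` S)) =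
        insert None (boundary_point ` S) \<union> insert None (boundary_point ` (\<lambda>x. x + \<tau>) ` S)"
      by (simp add: image_Un)
    ultimately show ?thesis
      by (simp only: \<Lambda>_def image_Un UN_Un_distrib)
  qed
  then show ?thesis
    using closure_\<Lambda>_subset_limit_set limit_set_subset_closure_\<Lambda> by (simp add: \<Gamma> V_def)
qed

end
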